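(* Let $F\ge1$, $N_{\max}\ge1$. Consider finite sets $A=\{(s_j,x_j,E_j)\}$ of triples with $s_j\in\mathbb{R}^F$, $x_j\in\mathbb{R}^{1\times3}$, $E_j\in\mathbb{R}^{3\times 3}$, with $|A|\le N_{\max}$ and with the $x_j$ pairwise distinct within $A$; write $\pi(A)=\{(s_j,x_j):(s_j,x_j,E_j)\in A\}$. There exist an integer $D$, a function $\varphi:\mathbb{R}^{3+9+F}\to\mathbb{R}^D$ and a function $\rho$ on $\mathbb{R}^D$ such that for every invertible $E\in\mathbb{R}^{3\times3}$ and all such sets $A,A'$, $$\rho\Big(\sum_{(s,x,E')\in A}\varphi\big(\mathrm{Concatenate}(xE^T,\,E'E^T,\,s)\big)\Big)=\rho\Big(\sum_{(s,x,E')\in A'}\varphi\big(\mathrm{Concatenate}(xE^T,\,E'E^T,\,s)\big)\Big)$$ implies $\pi(A)=\pi(A')$.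
   Context: $\mathrm{Concatenate}(xE^T,E'E^T,s)$ denotes the concatenation of the entries of $xE^T\in\mathbb{R}^{1\times 3}$, of the flattened matrix $E'E^T\in\mathbb{R}^{3\times 3}$ (the projection of the neighbour frame $E'$ onto the center frame $E$), and of $s\in\mathbb{R}^F$. *)

theory Defs
  imports "HOL-Analysis.Analysis"
begin

text \<open>A triple (s, x, E) with s in R^F (a real list of length F), x a row vector
  in R^{1x3} (represented as real^3) and E a 3x3 real matrix.\<close>
type_synonym triple = "real list \<times> (real^3) \<times> (real^3^3)"

text \<open>Admissible sets: finite, of cardinality at most Nmax, s of length F,
  and the positions x pairwise distinct.\<close>
definition admissible :: "nat \<Rightarrow> nat \<Rightarrow> triple set \<Rightarrow> bool" where
  "admissible F Nmax A \<longleftrightarrow> finite A \<and> card A \<le> Nmax \<and>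
     (\<forall>(s, x, E') \<in> A. length s = F) \<and>
     (\<forall>a\<in>A. \<forall>b\<in>A. fst (snd a) = fst (snd b) \<longrightarrow> a = b)"

definition proj :: "triple set \<Rightarrow> (real list \<times> (real^3)) set" where
  "proj A = (\<lambda>(s, x, E'). (s, x)) ` A"

definition idx3 :: "3 list" where "idx3 = [1, 2, 3]"

text \<open>Entries of a row vector and row-major flattening of a 3x3 matrix.\<close>
definition vec_entries :: "real^3 \<Rightarrow> real list" where
  "vec_entries v = map (\<lambda>i. v $ i) idx3"

definition mat_entries :: "real^3^3 \<Rightarrow> real list" where
  "mat_entries M = concat (map (\<lambda>i. map (\<lambda>j. M $ i $ j) idx3) idx3)"

text \<open>Concatenate(x E^T, E' E^T, s) in R^{3+9+F}. For the row vector x,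
  the row vector x E^T has entries (E *v x).\<close>
definition Concatenate :: "real^3 \<Rightarrow> real^3^3 \<Rightarrow> real list \<Rightarrow> real list" where
  "Concatenate xE EE s = vec_entries xE @ mat_entries EE @ s"

text \<open>Vectors in R^D are represented as functions nat => real supported on {..<D};
  sums are taken componentwise.\<close>
definition pool :: "(real list \<Rightarrow> (nat \<Rightarrow> real)) \<Rightarrow> real^3^3 \<Rightarrow> triple set \<Rightarrow> (nat \<Rightarrow> real)" where
  "pool \<phi> E A = (\<lambda>i. \<Sum>(s, x, E')\<in>A. \<phi> (Concatenate (E *v x) (E' ** transpose E) s) i)"

end

theory Submission
  imports Defs "HOL-Computational_Algebra.Polynomial"
begin

text \<open>Since the reals have the cardinality of real lists, every input vector \<open>v\<close> can be
  coded injectively by one real \<open>g v\<close>. Let \<open>\<phi> v\<close> list the powers \<open>g v ^ i\<close> for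
  \<open>i < 2 Nmax\<close> and let \<open>\<rho>\<close> be the identity: the pooled vector is then the list of the
  first \<open>2 Nmax\<close> power sums of the set of codes, and these determine a set of at most
  \<open>Nmax\<close> reals (sum, over both sets, the polynomial vanishing on all codes but one).
  For invertible \<open>E\<close> a feature vector determines \<open>s\<close> and \<open>x\<close>, and distinct positions make
  the features of an admissible set distinct, so the set of codes determines \<open>\<pi>(A)\<close>.\<close>

lemma sum_poly_eq_power_sums:
  fixes p :: "'a::comm_ring_1 poly"
  assumes "degree p < n"
  shows "(\<Sum>y\<in>S. poly p y) = (\<Sum>i<n. coeff p i * (\<Sum>y\<in>S. y ^ i))"
proof -
  have "poly p y = (\<Sum>i<n. coeff p i * y ^ i)" for y
    unfolding poly_altdef
    by (rule sum.mono_neutral_left) (use assms in \<open>auto simp: coeff_eq_0\<close>)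
  then show ?thesis
    by (simp add: sum_distrib_left sum.swap[of _ S] mult.commute)
qed

lemma power_sums_determine_subset:
  fixes S T :: "'a::idom set"
  assumes "finite S" "finite T" "card (S \<union> T) \<le> n"
    and power_sums: "\<And>i. i < n \<Longrightarrow> (\<Sum>y\<in>S. y ^ i) = (\<Sum>y\<in>T. y ^ i)"
  shows "S \<subseteq> T"
proof
  fix u assume u: "u \<in> S"
  show "u \<in> T"
  proof (rule ccontr)
    assume "u \<notin> T"
    define W where "W = (S \<union> T) - {u}"
    define P where "P = (\<Prod>w\<in>W. [:-w, 1:])"
    have "finite W" using assms by (simp add: W_def)
    have "card W < n"
      using assms u card_Diff1_less[of "S \<union> T" u] by (simp add: W_def)
    moreover have "degree P \<le> card W"
      using degree_prod_sum_le[OF \<open>finite W\<close>, of "\<lambda>w. [:-w, 1:]"] by (simp add: P_def o_def)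
    ultimately have "degree P < n" by linarith
    have poly_P: "poly P y = (\<Prod>w\<in>W. y - w)" for y
      by (simp add: P_def poly_prod)
    have vanish: "poly P y = 0" if "y \<in> W" for y
      using \<open>finite W\<close> that by (auto simp: poly_P intro: prod_zero)
    have "(\<Sum>y\<in>S. poly P y) = poly P u + (\<Sum>y\<in>S - {u}. poly P y)"
      using u assms(1) by (simp add: sum.remove)
    also have "\<dots> = poly P u"
      by (simp add: vanish W_def)
    finally have "poly P u = (\<Sum>y\<in>S. poly P y)" ..
    also have "\<dots> = (\<Sum>y\<in>T. poly P y)"
      using power_sums by (simp add: sum_poly_eq_power_sums[OF \<open>degree P < n\<close>])
    also have "\<dots> = 0"
      using \<open>u \<notin> T\<close> by (intro sum.neutral ballI vanish) (auto simp: W_def)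
    finally show False
      using \<open>finite W\<close> by (simp add: poly_P W_def)
  qed
qed

lemma power_sums_determine_set:
  fixes S T :: "'a::idom set"
  assumes "finite S" "finite T" "card S \<le> N" "card T \<le> N"
    and "\<And>i. i < 2 * N \<Longrightarrow> (\<Sum>y\<in>S. y ^ i) = (\<Sum>y\<in>T. y ^ i)"
  shows "S = T"
proof -
  have "card (S \<union> T) \<le> 2 * N" "card (T \<union> S) \<le> 2 * N"
    using card_Un_le[of S T] card_Un_le[of T S] assms(3,4) by linarith+
  with assms show ?thesis
    using power_sums_determine_subset[of S T "2 * N"] power_sums_determine_subset[of T S "2 * N"]
    by (simp add: subset_antisym)
qed

lemma ex_inj_real_pair: "\<exists>h :: real \<times> real \<Rightarrow> real. inj h"
proof -
  obtain h where "bij_betw h ((UNIV :: real set) \<times> (UNIV :: real set)) (UNIV :: real set)"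
    using card_of_ordIso[THEN iffD2, OF card_of_Times_same_infinite[OF infinite_UNIV_char_0]]
    by blast
  then show ?thesis by (auto simp: bij_betw_def)
qed

fun list_code :: "(real \<times> real \<Rightarrow> real) \<Rightarrow> real list \<Rightarrow> real" where
  "list_code h [] = 0"
| "list_code h (a # l) = h (a, list_code h l)"

lemma list_code_inj_same_length:
  assumes "inj h" "length l = length l'" "list_code h l = list_code h l'"
  shows "l = l'"
  using assms(2,3)
proof (induction l arbitrary: l')
  case (Cons a l)
  then show ?case by (cases l') (auto dest: injD[OF assms(1)])
qed simp

lemma ex_inj_real_list: "\<exists>g :: real list \<Rightarrow> real. inj g"
proof -
  obtain h :: "real \<times> real \<Rightarrow> real" where "inj h" using ex_inj_real_pair by blast
  have "inj (\<lambda>l. h (real (length l), list_code h l))"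
  proof (rule injI)
    fix l l' assume "h (real (length l), list_code h l) = h (real (length l'), list_code h l')"
    then have "length l = length l'" "list_code h l = list_code h l'"
      by (simp_all add: inj_eq[OF \<open>inj h\<close>])
    then show "l = l'" using list_code_inj_same_length[OF \<open>inj h\<close>] by blast
  qed
  then show ?thesis by blast
qed

lemma vec_entries_inj: "inj vec_entries"
  by (rule injI) (simp add: vec_entries_def idx3_def vec_eq_iff, metis exhaust_3)

lemma Concatenate_eq_imp:
  fixes E :: "real^3^3"
  assumes "invertible E" "Concatenate (E *v x) M s = Concatenate (E *v x') M' s'"
  shows "s = s'" "x = x'"
proof -
  have lengths: "length (vec_entries v) = 3" "length (mat_entries N) = 9" for v N
    by (simp_all add: vec_entries_def mat_entries_def idx3_def)
  have "inj ((*v) E)"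
    using assms(1) by (simp add: invertible_left_inverse matrix_left_invertible_injective)
  from assms(2) have "vec_entries (E *v x) = vec_entries (E *v x')" "s = s'"
    by (simp_all add: Concatenate_def append_eq_append_conv lengths)
  then show "s = s'" "x = x'"
    by (simp_all add: inj_eq[OF vec_entries_inj] inj_eq[OF \<open>inj ((*v) E)\<close>])
qed

definition feature :: "real^3^3 \<Rightarrow> triple \<Rightarrow> real list" where
  "feature E = (\<lambda>(s, x, E'). Concatenate (E *v x) (E' ** transpose E) s)"

definition power_features :: "nat \<Rightarrow> (real list \<Rightarrow> real) \<Rightarrow> real list \<Rightarrow> nat \<Rightarrow> real" where
  "power_features n g v i = (if i < n then g v ^ i else 0)"

lemma image_eq_if_determined:
  assumes "\<And>a b. f a = f b \<Longrightarrow> k a = k b" "f ` A = f ` B"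
  shows "k ` A = k ` B"
proof -
  have "k a = (k \<circ> inv f) (f a)" for a
    using assms(1)[of "inv f (f a)" a] f_inv_into_f[of "f a" f UNIV] by simp
  then have "k = (k \<circ> inv f) \<circ> f" by auto
  then show ?thesis by (metis assms(2) image_comp)
qed

lemma proj_eq_if_features_eq:
  assumes "invertible E" "feature E ` A = feature E ` A'"
  shows "proj A = proj A'"
  unfolding proj_def
  by (rule image_eq_if_determined[OF _ assms(2)])
     (auto simp: feature_def dest: Concatenate_eq_imp[OF assms(1)])

lemma inj_on_feature:
  assumes "invertible E" "admissible F N A"
  shows "inj_on (feature E) A"
proof (rule inj_onI)
  fix a b assume "a \<in> A" "b \<in> A" "feature E a = feature E b"
  then have "fst (snd a) = fst (snd b)"
    by (auto simp: feature_def split: prod.splits dest: Concatenate_eq_imp[OF assms(1)])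
  with assms(2) \<open>a \<in> A\<close> \<open>b \<in> A\<close> show "a = b" by (simp add: admissible_def)
qed

lemma pool_power_features:
  assumes "inj g" "invertible E" "admissible F N A" "i < n"
  shows "pool (power_features n g) E A i = (\<Sum>y\<in>(g \<circ> feature E) ` A. y ^ i)"
proof -
  have inj: "inj_on (g \<circ> feature E) A"
    using assms(1) inj_on_feature[OF assms(2,3)] by (simp add: comp_inj_on inj_on_subset)
  have "(\<Sum>y\<in>(g \<circ> feature E) ` A. y ^ i) = (\<Sum>a\<in>A. g (feature E a) ^ i)"
    using sum.reindex[OF inj, of "\<lambda>y. y ^ i"] by simp
  with assms(4) show ?thesis
    by (simp add: pool_def power_features_def feature_def case_prod_beta)
qed

lemma feature_image_eq_if_pool_eq:
  assumes "inj g" "invertible E" "admissible F N A" "admissible F N A'"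
    and pools: "pool (power_features (2 * N) g) E A = pool (power_features (2 * N) g) E A'"
  shows "feature E ` A = feature E ` A'"
proof -
  let ?codes = "\<lambda>B. (g \<circ> feature E) ` B"
  have finite: "finite (?codes B)" and card: "card (?codes B) \<le> N"
    if "admissible F N B" for B
    using that card_image_le[of B "g \<circ> feature E"] by (simp_all add: admissible_def)
  have "?codes A = ?codes A'"
  proof (rule power_sums_determine_set[OF finite[OF assms(3)] finite[OF assms(4)]
        card[OF assms(3)] card[OF assms(4)]])
    fix i assume i: "i < 2 * N"
    show "(\<Sum>y\<in>?codes A. y ^ i) = (\<Sum>y\<in>?codes A'. y ^ i)"
      using pool_power_features[OF assms(1-3) i] pool_power_features[OF assms(1,2,4) i]
        fun_cong[OF pools, of i]
      by simp
  qed
  then have "g ` feature E ` A = g ` feature E ` A'"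
    by (simp only: image_comp)
  then show ?thesis
    by (simp only: inj_image_eq_iff[OF \<open>inj g\<close>])
qed

theorem proposition5:
  fixes F Nmax :: nat
  assumes "F \<ge> 1" and "Nmax \<ge> 1"
  shows "\<exists>D::nat. \<exists>\<phi> :: real list \<Rightarrow> (nat \<Rightarrow> real). \<exists>\<rho> :: (nat \<Rightarrow> real) \<Rightarrow> (nat \<Rightarrow> real).
           (\<forall>v i. D \<le> i \<longrightarrow> \<phi> v i = 0) \<and>
           (\<forall>E A A'. invertible E \<longrightarrow> admissible F Nmax A \<longrightarrow> admissible F Nmax A' \<longrightarrow>
              \<rho> (pool \<phi> E A) = \<rho> (pool \<phi> E A') \<longrightarrow> proj A = proj A')"
proof -
  obtain g :: "real list \<Rightarrow> real" where "inj g" using ex_inj_real_list by blast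
  let ?\<phi> = "power_features (2 * Nmax) g"
  have "\<forall>v i. 2 * Nmax \<le> i \<longrightarrow> ?\<phi> v i = 0"
    by (simp add: power_features_def)
  moreover have "proj A = proj A'"
    if "invertible E" "admissible F Nmax A" "admissible F Nmax A'" "pool ?\<phi> E A = pool ?\<phi> E A'"
    for E A A'
    by (rule proj_eq_if_features_eq[OF that(1) feature_image_eq_if_pool_eq[OF \<open>inj g\<close> that]])
  ultimately show ?thesis
    by (intro exI[of _ "2 * Nmax"] exI[of _ ?\<phi>] exI[of _ "\<lambda>p. p"]) blast
qed

end
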